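(* Let $N$ be a positive integer and let $b,c,d,c'$ be complex parameters with $\Re(1-N+b+c-d)>0$. Then $$F_{1:1}^{0:3}\left[{-\atop d}:{-N,b,c\atop 1-N+b+c-d};{d+N,d-b,c'\atop 1+c+c'};1,1\right]=\frac{(d-b,\,d-c-c')_N}{(d,\,d-b-c)_N}\cdot\frac{\Gamma(1+c+c')\,\Gamma(1+b+c-d)}{\Gamma(1+c)\,\Gamma(1+b+c+c'-d)}.$$
   Context: $(x)_m=x(x+1)\cdots(x+m-1)$, $(x)_0=1$, is the Pochhammer symbol, and $(x_1,\dots,x_r)_m=(x_1)_m\cdots(x_r)_m$. The Kampé de Fériet series is $$F_{1:1}^{0:3}\left[{-\atop d}:{a,b,c\atop e};{a',b',c'\atop e'};x,y\right]=\sum_{m,n=0}^\infty\frac{(a,b,c)_m(a',b',c')_n}{(d)_{m+n}(e)_m(e')_n}\frac{x^my^n}{m!\,n!}.$$ It is absolutely convergent for $|x|=|y|=1$ when $\Re(d+e-a-b-c)>0$ and $\Re(d+e'-a'-b'-c')>0$. It is understood that no denominator parameter of the series (here $d$, $1-N+b+c-d$, $1+c+c'$) is zero or a negative integer; $1/\Gamma$ is taken to be $0$ at zero and the negative integers. *)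

theory Defs
  imports "HOL-Analysis.Analysis"
begin

text \<open>The Kampe de Feriet series with upper-left parameters empty, one common lower parameter
  \<open>d\<close>, and parameter blocks \<open>a, b, c; e\<close> and \<open>a', b', c'; e'\<close>. As an unordered sum over pairs of
  naturals of complex terms, summability is the same as absolute convergence.\<close>

definition kampe_de_feriet_term ::
  "complex \<Rightarrow> complex \<times> complex \<times> complex \<Rightarrow> complex \<Rightarrow>
   complex \<times> complex \<times> complex \<Rightarrow> complex \<Rightarrow> complex \<Rightarrow> complex \<Rightarrow> nat \<times> nat \<Rightarrow> complex" where
  "kampe_de_feriet_term d = (\<lambda>(a, b, c) e (a', b', c') e' x y (m, n).
     (pochhammer a m * pochhammer b m * pochhammer c m) *
     (pochhammer a' n * pochhammer b' n * pochhammer c' n) /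
     (pochhammer d (m + n) * pochhammer e m * pochhammer e' n) *
     (x ^ m * y ^ n / (fact m * fact n)))"

definition kampe_de_feriet ::
  "complex \<Rightarrow> complex \<times> complex \<times> complex \<Rightarrow> complex \<Rightarrow>
   complex \<times> complex \<times> complex \<Rightarrow> complex \<Rightarrow> complex \<Rightarrow> complex \<Rightarrow> complex" where
  "kampe_de_feriet d abc e abc' e' x y =
     (\<Sum>\<^sub>\<infinity>mn. kampe_de_feriet_term d abc e abc' e' x y mn)"

end

theory Submission
  imports Defs
begin

text \<open>
  Since \<open>(-N)\<^sub>m\<close> vanishes for \<open>m > N\<close>, only the sum over \<open>n\<close> is infinite. The numerator parameter
  \<open>d + N\<close> is tuned to the common denominator: \<open>(d + N)\<^sub>n / (d)\<^bsub>m+n\<^esub> = (d + m + n)\<^bsub>N-m\<^esub> / (d)\<^sub>N\<close>, a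
  polynomial in \<open>n\<close>. With \<open>a = d - b\<close>, Vandermonde's identity for the splitting
  \<open>d + m + n = (a + n) + (b + m)\<close> expands this polynomial in the basis \<open>(a + n)\<^sub>j\<close>, and
  \<open>(a)\<^sub>n (a + n)\<^sub>j = (a)\<^sub>j (a + j)\<^sub>n\<close> absorbs each basis element into a parameter of the series. So the
  double series is a finite sum over \<open>j \<le> N\<close> of products of a sum over \<open>m\<close> and a sum over \<open>n\<close>
  (\<open>kampe_de_feriet_term_separate\<close>).

  The sum over \<open>n\<close> is a series \<open>2F1(a + j, c'; 1 + c + c'; 1)\<close>, evaluated by Gauss's theorem
  (\<open>Gauss_2F1_sum\<close>); it converges absolutely for all \<open>j \<le> N\<close> because of the condition on the real
  part. In the sum over \<open>m\<close> the factors \<open>(b)\<^sub>m (b + m)\<^bsub>N-m-j\<^esub>\<close> merge into \<open>(b)\<^bsub>N-j\<^esub>\<close>, which leaves a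
  terminating \<open>2F1\<close>, evaluated by the Chu-Vandermonde identity (\<open>sum_fst_factor\<close>). In the product of the
  two values everything but \<open>(N choose j) (d - b - c - c')\<^sub>j (b)\<^bsub>N-j\<^esub>\<close> turns out to be independent of
  \<open>j\<close>, and Vandermonde's identity sums this over \<open>j\<close> to \<open>(d - c - c')\<^sub>N\<close>.

  Gauss's theorem itself is proved in the classical way: a telescoping contiguous relation links the
  sums for \<open>c\<close> and \<open>c + 1\<close>; after \<open>k\<close> steps the sum tends to 1, and the accumulated quotient of
  Pochhammer symbols tends to the quotient of Gamma values by Euler's limit formula.
\<close>

section \<open>Gauss's summation theorem\<close>

definition hypergeo_2F1_term :: "complex \<Rightarrow> complex \<Rightarrow> complex \<Rightarrow> nat \<Rightarrow> complex" where
  "hypergeo_2F1_term a b c n = pochhammer a n * pochhammer b n / (pochhammer c n * fact n)"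

text \<open>
  Euler's limit formula for \<open>1/\<Gamma>\<close>, applied to the four Pochhammer symbols of a term (the factorial
  being \<open>(1)\<^sub>n\<close>), shows that the term is a convergent sequence times \<open>n\<close> to the power \<open>a + b - c - 1\<close>.
\<close>

lemma norm_hypergeo_2F1_term_bound:
  assumes c: "c \<notin> \<int>\<^sub>\<le>\<^sub>0"
  obtains K where "K > 0"
    "\<And>n. n > 0 \<Longrightarrow>
       norm (hypergeo_2F1_term a b c (Suc n)) \<le> K * real n powr (- 1 - Re (c - a - b))"
proof -
  define q where "q = (\<lambda>n. rGamma_series a n * rGamma_series b n / (rGamma_series c n * rGamma_series 1 n))"
  have "q \<longlonglongrightarrow> rGamma a * rGamma b / (rGamma c * rGamma 1)"
    unfolding q_def using c by (intro tendsto_intros) (auto simp: rGamma_eq_zero_iff)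
  then have "Bseq q"
    by (intro convergent_imp_Bseq) (auto simp: convergent_def)
  then obtain K where K: "K > 0" "\<And>n. norm (q n) \<le> K"
    by (auto elim: BseqE)
  have eq: "hypergeo_2F1_term a b c (Suc n) = q n * of_nat n powr (a + b - c - 1)" if "n > 0" for n
  proof -
    define L :: complex where "L = of_real (ln (real n))"
    have "of_nat n powr (a + b - c - 1) = exp (a * L) * exp (b * L) / (exp (c * L) * exp (1 * L))"
      using that by (simp add: L_def powr_def Ln_of_nat exp_add[symmetric] exp_diff[symmetric]
          algebra_simps)
    moreover have "A * B / (C * F) = (A / (f * ea)) * (B / (f * eb)) / ((C / (f * ec)) * (F / (f * e1)))
        * (ea * eb / (ec * e1))"
      if "f \<noteq> 0" "ea \<noteq> 0" "eb \<noteq> 0" "ec \<noteq> 0" "e1 \<noteq> 0" for A B C F f ea eb ec e1 :: complex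
      using that by simp
    ultimately show ?thesis
      unfolding hypergeo_2F1_term_def q_def rGamma_series_def L_def[symmetric] Suc_eq_plus1 
        pochhammer_fact[of "n + 1"] by simp
  qed
  show ?thesis
  proof (rule that[OF K(1)])
    fix n :: nat assume n: "n > 0"
    have "norm (of_nat n powr (a + b - c - 1) :: complex) = real n powr (- 1 - Re (c - a - b))"
      using n by (simp add: norm_powr_real_powr algebra_simps)
    then show "norm (hypergeo_2F1_term a b c (Suc n)) \<le> K * real n powr (- 1 - Re (c - a - b))"
      using K(2)[of n] eq[OF n] by (simp add: norm_mult mult_right_mono)
  qed
qed

lemma summable_norm_hypergeo_2F1_term:
  assumes c: "c \<notin> \<int>\<^sub>\<le>\<^sub>0" and s: "Re (c - a - b) > 0"
  shows "summable (\<lambda>n. norm (hypergeo_2F1_term a b c n))"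
proof -
  obtain K where K: "K > 0" "\<And>n. n > 0 \<Longrightarrow>
       norm (hypergeo_2F1_term a b c (Suc n)) \<le> K * real n powr (- 1 - Re (c - a - b))"
    using norm_hypergeo_2F1_term_bound[OF c, where a = a and b = b] by blast
  have "summable (\<lambda>n. norm (hypergeo_2F1_term a b c (Suc n)))"
  proof (rule summable_comparison_test_ev)
    show "eventually (\<lambda>n. norm (norm (hypergeo_2F1_term a b c (Suc n))) \<le>
            K * real n powr (- 1 - Re (c - a - b))) sequentially"
      using eventually_gt_at_top[of 0] by eventually_elim (use K in auto)
    show "summable (\<lambda>n. K * real n powr (- 1 - Re (c - a - b)))"
      using s by (intro summable_mult) (simp add: summable_real_powr_iff)
  qed
  then show ?thesis
    using summable_Suc_iff[of "\<lambda>n. norm (hypergeo_2F1_term a b c n)"] by simp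
qed

text \<open>The vanishing of the boundary term in the telescoping sum of the contiguous relation.\<close>

lemma index_mult_hypergeo_2F1_term_tendsto_0:
  assumes c: "c \<notin> \<int>\<^sub>\<le>\<^sub>0" and s: "Re (c - a - b) > 0"
  shows "(\<lambda>n. of_nat n * hypergeo_2F1_term a b c n) \<longlonglongrightarrow> 0"
proof -
  define \<delta> where "\<delta> = Re (c - a - b)"
  have \<delta>: "\<delta> > 0" using s by (simp add: \<delta>_def)
  obtain K where K: "K > 0" "\<And>n. n > 0 \<Longrightarrow>
       norm (hypergeo_2F1_term a b c (Suc n)) \<le> K * real n powr (- 1 - \<delta>)"
    using norm_hypergeo_2F1_term_bound[OF c, where a = a and b = b] unfolding \<delta>_def by blast
  have "(\<lambda>n. of_nat (Suc n) * hypergeo_2F1_term a b c (Suc n)) \<longlonglongrightarrow> 0"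
  proof (rule Lim_null_comparison)
    show "eventually (\<lambda>n. norm (of_nat (Suc n) * hypergeo_2F1_term a b c (Suc n)) \<le>
            2 * K * real n powr (- \<delta>)) sequentially"
      using eventually_gt_at_top[of 0]
    proof eventually_elim
      case (elim n)
      have "norm (of_nat (Suc n) * hypergeo_2F1_term a b c (Suc n))
              \<le> real (Suc n) * (K * real n powr (- 1 - \<delta>))"
        unfolding norm_mult norm_of_nat using K(2)[OF elim] by (intro mult_left_mono) auto
      also have "\<dots> \<le> (2 * real n) * (K * real n powr (- 1 - \<delta>))"
        using elim K(1) by (intro mult_right_mono) auto
      also have "\<dots> = 2 * K * real n powr (- \<delta>)"
        using elim by (simp add: powr_diff powr_minus field_simps)
      finally show ?case .
    qed
    have "(\<lambda>n. real n powr (- \<delta>)) \<longlonglongrightarrow> 0"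
      using \<delta> by (intro tendsto_neg_powr filterlim_real_sequentially) auto
    then show "(\<lambda>n. 2 * K * real n powr (- \<delta>)) \<longlonglongrightarrow> 0"
      by (rule tendsto_mult_right_zero)
  qed
  then show ?thesis by (subst (asm) filterlim_sequentially_Suc)
qed

text \<open>
  Writing \<open>t\<^sub>n\<close> for the terms with parameter \<open>c\<close> and \<open>u\<^sub>n\<close> for those with \<open>c + 1\<close>, one has
  \<open>u\<^sub>n = t\<^sub>n c / (c + n)\<close>, and \<open>c (c - a - b) t\<^sub>n - (c - a) (c - b) u\<^sub>n\<close> is the difference of
  consecutive values of \<open>- c n t\<^sub>n\<close>.
\<close>

lemma suminf_hypergeo_2F1_contiguous:
  assumes c: "c \<notin> \<int>\<^sub>\<le>\<^sub>0" and s: "Re (c - a - b) > 0"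
  shows "c * (c - a - b) * suminf (hypergeo_2F1_term a b c) =
         (c - a) * (c - b) * suminf (hypergeo_2F1_term a b (c + 1))"
proof -
  let ?t = "hypergeo_2F1_term a b"
  have nz: "c + of_nat n \<noteq> 0" for n
    using c plus_of_nat_eq_0_imp by blast
  have c1: "c + 1 \<notin> \<int>\<^sub>\<le>\<^sub>0" using c plus_one_in_nonpos_Ints_imp by blast
  have s1: "Re (c + 1 - a - b) > 0" using s by simp
  have S0: "?t c sums suminf (?t c)" and S1: "?t (c + 1) sums suminf (?t (c + 1))"
    using summable_norm_hypergeo_2F1_term[OF c s] summable_norm_hypergeo_2F1_term[OF c1 s1]
    by (auto dest: summable_norm_cancel intro: summable_sums)
  define G where "G = (\<lambda>n. - c * (of_nat n * ?t c n))"
  have step: "c * (c - a - b) * ?t c n - (c - a) * (c - b) * ?t (c + 1) n = G (Suc n) - G n" for n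
  proof -
    have P: "pochhammer (c + 1) n * c = pochhammer c n * (c + of_nat n)"
      using pochhammer_rec[of c n] pochhammer_rec'[of c n] by (simp add: mult_ac)
    have p0: "pochhammer c n \<noteq> 0" "pochhammer (c + 1) n \<noteq> 0" "c \<noteq> 0"
      using c c1 pochhammer_eq_0_imp_nonpos_Int by auto
    have t1: "?t (c + 1) n = ?t c n * c / (c + of_nat n)"
    proof -
      have "pochhammer (c + 1) n = pochhammer c n * (c + of_nat n) / c"
        using P p0 by (simp add: field_simps)
      then show ?thesis
        unfolding hypergeo_2F1_term_def by simp
    qed
    have t2: "of_nat (Suc n) * ?t c (Suc n) = (a + of_nat n) * (b + of_nat n) / (c + of_nat n) * ?t c n"
      using p0 nz[of n] unfolding hypergeo_2F1_term_def
      by (simp add: pochhammer_rec' divide_simps del: of_nat_Suc) 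
    show ?thesis unfolding G_def t1 t2 using nz[of n]
      by (simp add: divide_simps) (simp add: algebra_simps)
  qed
  have "(\<lambda>n. G (Suc n) - G n) sums (0 - G 0)"
  proof (rule telescope_sums)
    show "G \<longlonglongrightarrow> 0" unfolding G_def
      by (intro tendsto_mult_right_zero index_mult_hypergeo_2F1_term_tendsto_0 c s)
  qed
  moreover have "(\<lambda>n. c * (c - a - b) * ?t c n - (c - a) * (c - b) * ?t (c + 1) n) sums
      (c * (c - a - b) * suminf (?t c) - (c - a) * (c - b) * suminf (?t (c + 1)))"
    by (intro sums_diff sums_mult S0 S1)
  ultimately show ?thesis
    unfolding step by (auto simp: G_def dest: sums_unique2)
qed

text \<open>
  The term of index 0 is 1. Once the denominator parameter \<open>c0\<close> has positive real part, adding \<open>k\<close> to it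
  enlarges every factor of the denominators in modulus, and the first factor grows at least to modulus
  \<open>k\<close>. All terms of positive index therefore shrink at least by the factor \<open>\<bar>c0\<bar> / k\<close>,
  uniformly in the index.
\<close>

lemma suminf_hypergeo_2F1_shift_tendsto_1:
  assumes s: "Re (c - a - b) > 0"
  shows "(\<lambda>k. suminf (hypergeo_2F1_term a b (c + of_nat k))) \<longlonglongrightarrow> 1"
proof -
  let ?t = "hypergeo_2F1_term a b"
  have t0: "?t z 0 = 1" for z
    by (simp add: hypergeo_2F1_term_def)
  obtain K :: nat where "K > - Re c" using reals_Archimedean2 by blast
  define c0 where "c0 = c + of_nat K"
  have Re0: "Re c0 > 0" using \<open>K > - Re c\<close> by (simp add: c0_def)
  have non: "c0 + of_nat k \<notin> \<int>\<^sub>\<le>\<^sub>0" for k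
    using Re0 by (auto elim!: nonpos_Ints_cases simp: complex_eq_iff)
  have sum: "summable (\<lambda>n. norm (?t (c0 + of_nat k) n))" for k
    by (rule summable_norm_hypergeo_2F1_term[OF non]) (use s in \<open>simp add: c0_def\<close>)
  define B where "B = (\<Sum>n. norm (?t c0 n))"
  have "(\<lambda>k. suminf (?t (c0 + of_nat k)) - 1) \<longlonglongrightarrow> 0"
  proof (rule Lim_null_comparison)
    show "eventually (\<lambda>k. norm (suminf (?t (c0 + of_nat k)) - 1) \<le> norm c0 * B / real k) sequentially"
      using eventually_gt_at_top[of 0]
    proof eventually_elim
      case (elim k)
      let ?c = "c0 + of_nat k"
      have le: "norm (?t ?c (Suc n)) \<le> norm c0 / real k * norm (?t c0 (Suc n))" for n
      proof -
        have k: "real k \<le> norm ?c"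
          using abs_Re_le_cmod[of ?c] Re0 by simp
        have "norm (pochhammer (c0 + 1) n) \<le> norm (pochhammer (?c + 1) n)"
          unfolding pochhammer_prod prod_norm[symmetric]
        proof (intro prod_mono conjI norm_ge_zero)
          fix i 
          show "norm (c0 + 1 + of_nat i) \<le> norm (?c + 1 + of_nat i)"
            using Re0 by (simp add: cmod_def)
        qed
        then have "real k * norm (pochhammer (c0 + 1) n) \<le> norm ?c * norm (pochhammer (?c + 1) n)"
          using k by (intro mult_mono) auto
        moreover have "norm (pochhammer c0 (Suc n)) = norm c0 * norm (pochhammer (c0 + 1) n)"
          by (simp add: pochhammer_rec norm_mult)
        moreover have "norm (pochhammer ?c (Suc n)) = norm ?c * norm (pochhammer (?c + 1) n)"
          by (simp add: pochhammer_rec norm_mult)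
        ultimately have le: "real k * norm (pochhammer c0 (Suc n)) \<le> norm c0 * norm (pochhammer ?c (Suc n))"
          using mult_left_mono[of "real k * norm (pochhammer (c0 + 1) n)"
              "norm ?c * norm (pochhammer (?c + 1) n)" "norm c0"] by (simp add: mult_ac)
        have nz: "pochhammer c0 (Suc n) \<noteq> 0" "pochhammer ?c (Suc n) \<noteq> 0"
          using non[of 0] non[of k] pochhammer_eq_0_imp_nonpos_Int by (auto simp del: pochhammer_Suc)
        have "1 / norm (pochhammer ?c (Suc n)) \<le> norm c0 / real k / norm (pochhammer c0 (Suc n))"
          using le nz elim by (simp add: field_simps)
        from mult_left_mono[OF this, of "norm (pochhammer a (Suc n) * pochhammer b (Suc n) / fact (Suc n))"]
        show ?thesis
          by (simp add: hypergeo_2F1_term_def norm_mult norm_divide mult_ac del: pochhammer_Suc fact_Suc)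
      qed
      have S: "summable (\<lambda>n. norm (?t ?c (Suc n)))"
        using sum[of k] summable_Suc_iff[of "\<lambda>n. norm (?t ?c n)"] by simp
      have S0: "summable (\<lambda>n. norm (?t c0 (Suc n)))"
        using sum[of 0] summable_Suc_iff[of "\<lambda>n. norm (?t c0 n)"] by simp
      have "suminf (?t ?c) - 1 = (\<Sum>n. ?t ?c (Suc n))"
        using suminf_split_head[OF summable_norm_cancel[OF sum[of k]]]
        by (simp add: t0)
      also have "norm \<dots> \<le> (\<Sum>n. norm (?t ?c (Suc n)))"
        by (rule summable_norm[OF S])
      also have "\<dots> \<le> (\<Sum>n. norm c0 / real k * norm (?t c0 (Suc n)))"
        by (intro suminf_le le S summable_mult S0)
      also have "\<dots> = norm c0 / real k * (\<Sum>n. norm (?t c0 (Suc n)))"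
        by (rule suminf_mult[OF S0])
      also have "\<dots> \<le> norm c0 / real k * B"
        using suminf_split_head[of "\<lambda>n. norm (?t c0 n)"] sum[of 0] unfolding B_def
        by (intro mult_left_mono) (auto simp: t0)
      finally show ?case by simp
    qed
    show "(\<lambda>k. norm c0 * B / real k) \<longlonglongrightarrow> 0"
      by (rule lim_const_over_n)
  qed
  then have "(\<lambda>k. suminf (?t (c0 + of_nat k))) \<longlonglongrightarrow> 1"
    by (simp add: LIM_zero_iff)
  then have "(\<lambda>k. suminf (?t (c + of_nat (k + K)))) \<longlonglongrightarrow> 1"
    by (simp add: c0_def add_ac)
  then show ?thesis by (rule LIMSEQ_offset)
qed

theorem Gauss_2F1_sum:
  assumes c: "c \<notin> \<int>\<^sub>\<le>\<^sub>0" and s: "Re (c - a - b) > 0"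
  shows "suminf (hypergeo_2F1_term a b c) =
         Gamma c * Gamma (c - a - b) * rGamma (c - a) * rGamma (c - b)"
proof -
  let ?F = "\<lambda>k. suminf (hypergeo_2F1_term a b (c + of_nat k))"
  have s': "c - a - b \<notin> \<int>\<^sub>\<le>\<^sub>0"
    using s by (auto elim!: nonpos_Ints_cases simp: complex_eq_iff)
  have iter: "pochhammer c k * pochhammer (c - a - b) k * ?F 0 =
      pochhammer (c - a) k * pochhammer (c - b) k * ?F k" for k
  proof (induction k)
    case (Suc k)
    have ck: "c + of_nat k \<notin> \<int>\<^sub>\<le>\<^sub>0" using c nonpos_Ints_diff_Nats[of "c + of_nat k" "of_nat k"] by auto
    have sk: "Re (c + of_nat k - a - b) > 0" using s by simp
    have "pochhammer c (Suc k) * pochhammer (c - a - b) (Suc k) * ?F 0 =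
        (c + of_nat k) * (c + of_nat k - a - b) * (pochhammer c k * pochhammer (c - a - b) k * ?F 0)"
      by (simp add: pochhammer_rec' algebra_simps)
    also have "\<dots> = pochhammer (c - a) k * pochhammer (c - b) k *
        ((c + of_nat k) * (c + of_nat k - a - b) * ?F k)"
      unfolding Suc by (simp add: mult_ac)
    also have "\<dots> = pochhammer (c - a) k * pochhammer (c - b) k *
        ((c + of_nat k - a) * (c + of_nat k - b) * ?F (Suc k))"
      unfolding suminf_hypergeo_2F1_contiguous[OF ck sk] by (simp add: add_ac)
    also have "\<dots> = pochhammer (c - a) (Suc k) * pochhammer (c - b) (Suc k) * ?F (Suc k)"
      by (simp add: pochhammer_rec' algebra_simps)
    finally show ?case .
  qed simp
  have series: "rGamma_series c k * rGamma_series (c - a - b) k * ?F 0 =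
      rGamma_series (c - a) k * rGamma_series (c - b) k * ?F (Suc k)" for k
  proof -
    define L :: complex where "L = of_real (ln (real k))"
    have E: "exp (c * L) * exp ((c - a - b) * L) = exp ((c - a) * L) * exp ((c - b) * L)"
      by (simp add: exp_add[symmetric] algebra_simps)
    have "rGamma_series c k * rGamma_series (c - a - b) k * ?F 0 =
       pochhammer c (Suc k) * pochhammer (c - a - b) (Suc k) * ?F 0 / 
       (fact k * fact k * (exp (c * L) * exp ((c - a - b) * L)))"
      by (simp add: rGamma_series_def L_def mult_ac)
    also have "\<dots> = rGamma_series (c - a) k * rGamma_series (c - b) k * ?F (Suc k)"
      unfolding iter E by (simp add: rGamma_series_def L_def mult_ac)
    finally show ?thesis .
  qed
  have "(\<lambda>k. rGamma_series c k * rGamma_series (c - a - b) k * ?F 0) \<longlonglongrightarrow> 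
      rGamma c * rGamma (c - a - b) * ?F 0"
    by (intro tendsto_intros)
  moreover have "(\<lambda>k. rGamma_series (c - a) k * rGamma_series (c - b) k * ?F (Suc k)) \<longlonglongrightarrow> 
      rGamma (c - a) * rGamma (c - b) * 1"
    by (intro tendsto_intros LIMSEQ_Suc suminf_hypergeo_2F1_shift_tendsto_1 s)
  ultimately have "rGamma c * rGamma (c - a - b) * ?F 0 = rGamma (c - a) * rGamma (c - b)"
    unfolding series using LIMSEQ_unique by fastforce
  then show ?thesis
    using c s' by (simp add: Gamma_def rGamma_eq_zero_iff field_simps)
qed

section \<open>Finite sums of Pochhammer symbols\<close>

lemma pochhammer_reflect:
  fixes x :: "'a :: comm_ring_1"
  shows "pochhammer x k = (- 1) ^ k * pochhammer (1 - x - of_nat k) k"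
  using pochhammer_minus[of "- x" k] by (simp add: algebra_simps)

text \<open>
  Over the common denominator \<open>(e)\<^sub>M\<close> the summand contains \<open>(e + m)\<^bsub>M-m\<^esub>\<close>, whose parameter depends on
  \<open>m\<close>. Reflection turns it into \<open>(1 - e - M)\<^bsub>M-m\<^esub>\<close> and cancels the alternating sign, so that the
  Vandermonde identity for Pochhammer symbols applies.
\<close>

lemma Chu_Vandermonde_alternating:
  fixes c e :: "'a :: field_char_0"
  assumes "pochhammer e M \<noteq> 0"
  shows "(\<Sum>m\<le>M. (- 1) ^ m * of_nat (M choose m) * pochhammer c m / pochhammer e m) =
         pochhammer (e - c) M / pochhammer e M"
proof -
  have "(- 1) ^ m * of_nat (M choose m) * pochhammer c m / pochhammer e m =
      (- 1) ^ M * (of_nat (M choose m) * pochhammer c m * pochhammer (1 - e - of_nat M) (M - m))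
        / pochhammer e M" if "m \<le> M" for m
  proof -
    have split: "pochhammer e M = pochhammer e m * pochhammer (e + of_nat m) (M - m)"
      using that by (rule pochhammer_product)
    have "pochhammer (e + of_nat m) (M - m) =
        (- 1) ^ (M - m) * pochhammer (1 - e - of_nat M) (M - m)"
      using that by (subst pochhammer_reflect) (simp add: of_nat_diff algebra_simps)
    moreover have "(- 1) ^ M = (- 1 :: 'a) ^ m * (- 1) ^ (M - m)"
      using that by (simp flip: power_add)
    moreover have "(- 1 :: 'a) ^ (M - m) * (- 1) ^ (M - m) = 1"
      by (simp flip: power_mult_distrib)
    ultimately show ?thesis
      using assms unfolding split by (simp add: field_simps)
  qed
  then have "(\<Sum>m\<le>M. (- 1) ^ m * of_nat (M choose m) * pochhammer c m / pochhammer e m) =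
      (\<Sum>m\<le>M. (- 1) ^ M * (of_nat (M choose m) * pochhammer c m * pochhammer (1 - e - of_nat M) (M - m))
        / pochhammer e M)"
    by (intro sum.cong) auto
  also have "\<dots> = (- 1) ^ M * pochhammer (c + (1 - e - of_nat M)) M / pochhammer e M"
    unfolding pochhammer_binomial_sum by (simp add: sum_distrib_left sum_divide_distrib)
  also have "\<dots> = pochhammer (e - c) M / pochhammer e M"
    by (subst (2) pochhammer_reflect) (simp add: algebra_simps)
  finally show ?thesis .
qed

section \<open>Separating the double series\<close>

lemma has_sum_sum:
  fixes f :: "'i \<Rightarrow> 'a \<Rightarrow> 'b :: topological_comm_monoid_add"
  assumes "\<And>j. j \<in> J \<Longrightarrow> (f j has_sum S j) A"
  shows "((\<lambda>x. \<Sum>j\<in>J. f j x) has_sum (\<Sum>j\<in>J. S j)) A"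
  using assms by (induction J rule: infinite_finite_induct) (auto intro: has_sum_add)

lemma has_sum_times_finite_support:
  fixes h g :: "nat \<Rightarrow> complex"
  assumes h: "\<And>m. m > N \<Longrightarrow> h m = 0" and g: "summable (\<lambda>n. norm (g n))"
  shows "(\<lambda>p. norm (case p of (m, n) \<Rightarrow> h m * g n)) summable_on UNIV"
    and "((\<lambda>(m, n). h m * g n) has_sum (\<Sum>m\<le>N. h m) * suminf g) UNIV"
proof -
  have "((\<lambda>n. norm (h m * g n)) has_sum norm (h m) * (\<Sum>n. norm (g n))) UNIV" for m
    unfolding norm_mult using g
    by (intro has_sum_cmult_right norm_summable_imp_has_sum) (auto simp: summable_sums)
  moreover have "(\<lambda>m. norm (h m) * (\<Sum>n. norm (g n))) summable_on UNIV"
    by (rule has_sum_imp_summable, rule has_sum_finite_neutralI[of "{..N}"]) (auto simp: h)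
  ultimately have "(\<lambda>p. norm (case p of (m, n) \<Rightarrow> h m * g n)) summable_on (UNIV \<times> UNIV)"
    by (intro summable_on_SigmaI) auto
  then show abs: "(\<lambda>p. norm (case p of (m, n) \<Rightarrow> h m * g n)) summable_on UNIV"
    by simp
  have "((\<lambda>(m, n). h m * g n) has_sum (\<Sum>m\<le>N. h m) * suminf g) (UNIV \<times> UNIV)"
  proof (rule has_sum_SigmaI)
    show "((\<lambda>n. case (m, n) of (m, n) \<Rightarrow> h m * g n) has_sum h m * suminf g) UNIV" for m
      unfolding prod.case using g
      by (intro has_sum_cmult_right norm_summable_imp_has_sum)
        (auto intro: summable_sums summable_norm_cancel)
    show "((\<lambda>m. h m * suminf g) has_sum (\<Sum>m\<le>N. h m) * suminf g) UNIV"
      by (rule has_sum_finite_neutralI[of "{..N}"]) (auto simp: h sum_distrib_right)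
    show "(\<lambda>(m, n). h m * g n) summable_on UNIV \<times> UNIV"
      using abs_summable_summable[OF abs] by simp
  qed
  then show "((\<lambda>(m, n). h m * g n) has_sum (\<Sum>m\<le>N. h m) * suminf g) UNIV"
    by simp
qed

text \<open>
  The factor in \<open>m\<close> of the \<open>j\<close>-th product in the expansion of the double series. It
  vanishes for \<open>m + j > N\<close>, where the subtractions are truncated: if \<open>m > N\<close> because of \<open>(-N)\<^sub>m\<close>, and
  otherwise because of the binomial coefficient.
\<close>

definition fst_factor ::
  "nat \<Rightarrow> complex \<Rightarrow> complex \<Rightarrow> complex \<Rightarrow> complex \<Rightarrow> nat \<Rightarrow> nat \<Rightarrow> complex" where
  "fst_factor N b c d e j m =
     pochhammer (- of_nat N) m * pochhammer b m * pochhammer c m / (pochhammer e m * fact m) *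
     of_nat ((N - m) choose j) * pochhammer (b + of_nat m) (N - m - j) / pochhammer d N"

definition snd_factor :: "complex \<Rightarrow> complex \<Rightarrow> complex \<Rightarrow> nat \<Rightarrow> nat \<Rightarrow> complex" where
  "snd_factor a c' e' j n = pochhammer a j * hypergeo_2F1_term (a + of_nat j) c' e' n"

text \<open>
  The indices \<open>m\<close> and \<open>n\<close> are coupled only by the quotient \<open>(d + N)\<^sub>n / (d)\<^bsub>m+n\<^esub>\<close>, and Vandermonde's
  identity for \<open>(d + m + n)\<^bsub>N-m\<^esub>\<close> decouples it.
\<close>

lemma kampe_de_feriet_term_separate:
  assumes d: "d \<notin> \<int>\<^sub>\<le>\<^sub>0"
  shows "kampe_de_feriet_term d (- of_nat N, b, c) e (d + of_nat N, d - b, c') e' 1 1 (m, n) =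
         (\<Sum>j\<le>N. fst_factor N b c d e j m * snd_factor (d - b) c' e' j n)"
proof (cases "m \<le> N")
  case False
  then show ?thesis
    by (simp add: kampe_de_feriet_term_def fst_factor_def pochhammer_of_nat_eq_0_lemma)
next
  case True
  define Q where "Q = pochhammer (- of_nat N) m * pochhammer b m * pochhammer c m / (pochhammer e m * fact m)"
  have d0: "pochhammer d k \<noteq> 0" for k
    using d pochhammer_eq_0_imp_nonpos_Int by blast
  have "pochhammer d N * pochhammer (d + of_nat N) n =
        pochhammer d (m + n) * pochhammer (d + of_nat (m + n)) (N - m)"
    using pochhammer_product'[of d N n] pochhammer_product'[of d "m + n" "N - m"] True
    by (simp add: add_ac)
  then have quot: "pochhammer (d + of_nat N) n / pochhammer d (m + n) =
      pochhammer (d + of_nat (m + n)) (N - m) / pochhammer d N"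
    using d0 by (simp add: field_simps)
  have swap: "pochhammer (d - b) n * pochhammer (d - b + of_nat n) j =
      pochhammer (d - b) j * pochhammer (d - b + of_nat j) n" for j
    using pochhammer_product'[of "d - b" n j] pochhammer_product'[of "d - b" j n]
    by (simp add: add.commute)
  have vdm: "pochhammer (d + of_nat (m + n)) (N - m) =
      (\<Sum>j\<le>N. of_nat ((N - m) choose j) * pochhammer (d - b + of_nat n) j *
        pochhammer (b + of_nat m) (N - m - j))"
  proof -
    have "pochhammer (d + of_nat (m + n)) (N - m) =
        pochhammer ((d - b + of_nat n) + (b + of_nat m)) (N - m)"
      by (simp add: algebra_simps)
    also have "\<dots> = (\<Sum>j\<le>N - m. of_nat ((N - m) choose j) * pochhammer (d - b + of_nat n) j *
        pochhammer (b + of_nat m) (N - m - j))"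
      by (rule pochhammer_binomial_sum)
    also have "\<dots> = (\<Sum>j\<le>N. of_nat ((N - m) choose j) * pochhammer (d - b + of_nat n) j *
        pochhammer (b + of_nat m) (N - m - j))"
      by (intro sum.mono_neutral_left) auto
    finally show ?thesis .
  qed
  have "kampe_de_feriet_term d (- of_nat N, b, c) e (d + of_nat N, d - b, c') e' 1 1 (m, n) =
      Q * (pochhammer (d - b) n * pochhammer c' n / (pochhammer e' n * fact n)) *
      (pochhammer (d + of_nat N) n / pochhammer d (m + n))"
    by (simp add: kampe_de_feriet_term_def Q_def mult_ac)
  also have "\<dots> = (\<Sum>j\<le>N. Q * (pochhammer c' n / (pochhammer e' n * fact n)) *
      (of_nat ((N - m) choose j) * pochhammer (b + of_nat m) (N - m - j) *
       (pochhammer (d - b) n * pochhammer (d - b + of_nat n) j)) / pochhammer d N)"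
    unfolding quot vdm sum_distrib_left sum_divide_distrib by (simp add: mult_ac)
  also have "\<dots> = (\<Sum>j\<le>N. fst_factor N b c d e j m * snd_factor (d - b) c' e' j n)"
    unfolding swap fst_factor_def snd_factor_def hypergeo_2F1_term_def Q_def
    by (intro sum.cong) (simp_all add: mult_ac)
  finally show ?thesis .
qed

text \<open>
  The identity \<open>(N choose m) (N - m choose j) = (N choose j) (N - j choose m)\<close> together with
  \<open>(b)\<^sub>m (b + m)\<^bsub>N-m-j\<^esub> = (b)\<^bsub>N-j\<^esub>\<close> removes all dependence on \<open>m\<close> except for the alternating
  Chu-Vandermonde summand of order \<open>N - j\<close>.
\<close>

lemma sum_fst_factor:
  assumes j: "j \<le> N" and e: "pochhammer e (N - j) \<noteq> 0"
  shows "(\<Sum>m\<le>N. fst_factor N b c d e j m) =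
         of_nat (N choose j) * pochhammer b (N - j) * pochhammer (e - c) (N - j) /
         (pochhammer e (N - j) * pochhammer d N)"
proof -
  have eq: "fst_factor N b c d e j m = of_nat (N choose j) * pochhammer b (N - j) / pochhammer d N *
      ((- 1) ^ m * of_nat ((N - j) choose m) * pochhammer c m / pochhammer e m)"
    if m: "m \<le> N - j" for m
  proof -
    have "pochhammer (- of_nat N) m / fact m = ((- 1) ^ m * of_nat (N choose m) :: complex)"
      by (simp add: binomial_gbinomial gbinomial_pochhammer flip: mult.assoc power_mult_distrib)
    moreover have "of_nat (N choose m) * of_nat ((N - m) choose j) =
        (of_nat (N choose j) * of_nat ((N - j) choose m) :: complex)"
      using m j by (simp add: binomial_fact diff_commute add.commute)
    moreover have "pochhammer b (N - j) = pochhammer b m * pochhammer (b + of_nat m) (N - m - j)"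
      using pochhammer_product[OF m, of b] by (simp add: add.commute)
    moreover have "fst_factor N b c d e j m = pochhammer (- of_nat N) m / fact m * of_nat ((N - m) choose j) *
      (pochhammer b m * pochhammer (b + of_nat m) (N - m - j)) * (pochhammer c m / pochhammer e m) / pochhammer d N"
      by (simp add: fst_factor_def mult_ac)
    ultimately show ?thesis by (simp add: mult_ac)
  qed
  have "(\<Sum>m\<le>N. fst_factor N b c d e j m) = (\<Sum>m\<le>N - j. fst_factor N b c d e j m)"
    by (rule sum.mono_neutral_right) (auto simp: fst_factor_def)
  also have "\<dots> = (\<Sum>m\<le>N - j. of_nat (N choose j) * pochhammer b (N - j) / pochhammer d N *
      ((- 1) ^ m * of_nat ((N - j) choose m) * pochhammer c m / pochhammer e m))"
    using eq by (intro sum.cong) auto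
  also have "\<dots> = of_nat (N choose j) * pochhammer b (N - j) / pochhammer d N *
      (pochhammer (e - c) (N - j) / pochhammer e (N - j))"
    unfolding sum_distrib_left[symmetric] Chu_Vandermonde_alternating[OF e] ..
  finally show ?thesis by (simp add: mult_ac)
qed

section \<open>The summation formula\<close>

theorem mainTheorem8:
  fixes N :: nat and b c d c' :: complex
  assumes "N > 0"
    and "Re (1 - of_nat N + b + c - d) > 0"
    and "d \<notin> \<int>\<^sub>\<le>\<^sub>0"
    and "1 - of_nat N + b + c - d \<notin> \<int>\<^sub>\<le>\<^sub>0"
    and "1 + c + c' \<notin> \<int>\<^sub>\<le>\<^sub>0"
  shows "(\<lambda>mn. norm (kampe_de_feriet_term d (- of_nat N, b, c) (1 - of_nat N + b + c - d)
           (d + of_nat N, d - b, c') (1 + c + c') 1 1 mn)) summable_on UNIV \<and>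
         kampe_de_feriet d (- of_nat N, b, c) (1 - of_nat N + b + c - d)
           (d + of_nat N, d - b, c') (1 + c + c') 1 1 =
         (pochhammer (d - b) N * pochhammer (d - c - c') N) /
         (pochhammer d N * pochhammer (d - b - c) N) *
         (Gamma (1 + c + c') * Gamma (1 + b + c - d) *
          (rGamma (1 + c) * rGamma (1 + b + c + c' - d)))"
proof -
  define a where "a = d - b"
  define e where "e = 1 - of_nat N + b + c - d"
  define e' where "e' = 1 + c + c'"
  define s where "s = 1 + b + c - d"
  let ?T = "kampe_de_feriet_term d (- of_nat N, b, c) e (d + of_nat N, a, c') e' 1 1"
  let ?h = "fst_factor N b c d e" and ?g = "snd_factor a c' e'"
  note e'_notin = assms(5)[folded e'_def]
  have Re_s: "Re (s - of_nat j) > 0" if "j \<le> N" for j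
    using assms(2) that by (simp add: s_def)
  have s_notin: "s - of_nat j \<notin> \<int>\<^sub>\<le>\<^sub>0" if "j \<le> N" for j
    using Re_s[OF that] by (auto elim!: nonpos_Ints_cases simp: complex_eq_iff)
  have e_nz: "pochhammer e k \<noteq> 0" for k
    using assms(4) pochhammer_eq_0_imp_nonpos_Int unfolding e_def by blast
  have Re_j: "Re (e' - (a + of_nat j) - c') > 0" if "j \<le> N" for j
    using Re_s[OF that] by (simp add: e'_def a_def s_def)
  have sum_t: "summable (\<lambda>n. norm (hypergeo_2F1_term (a + of_nat j) c' e' n))" if "j \<le> N" for j
    by (rule summable_norm_hypergeo_2F1_term[OF e'_notin Re_j[OF that]])
  have sum_g: "summable (\<lambda>n. norm (?g j n))" if "j \<le> N" for j
    unfolding snd_factor_def norm_mult by (intro summable_mult sum_t that)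
  have h0: "?h j m = 0" if "m > N" for j m
    using that by (simp add: fst_factor_def pochhammer_of_nat_eq_0_lemma)
  have T: "?T = (\<lambda>p. \<Sum>j\<le>N. case p of (m, n) \<Rightarrow> ?h j m * ?g j n)"
    using kampe_de_feriet_term_separate[OF assms(3)] unfolding a_def by (auto simp: fun_eq_iff)
  have factors: "(\<lambda>p. norm (case p of (m, n) \<Rightarrow> ?h j m * ?g j n)) summable_on UNIV"
      "((\<lambda>(m, n). ?h j m * ?g j n) has_sum (\<Sum>m\<le>N. ?h j m) * suminf (?g j)) UNIV"
    if "j \<in> {..N}" for j
    using has_sum_times_finite_support[of N "?h j" "?g j"] h0 sum_g that by auto
  have "(\<lambda>p. \<Sum>j\<le>N. norm (case p of (m, n) \<Rightarrow> ?h j m * ?g j n)) summable_on UNIV"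
    by (rule has_sum_imp_summable, rule has_sum_sum, rule has_sum_infsum, rule factors(1))
  then have abs: "(\<lambda>p. norm (?T p)) summable_on UNIV"
    unfolding T by (rule Infinite_Sum.abs_summable_on_comparison_test') (rule norm_sum)

  define K where "K = Gamma e' * Gamma s * (rGamma (1 + c) * rGamma (e' - a))"
  \<comment> \<open>The parts of the two sums fit together because \<open>s = e + N\<close> merges \<open>(e)\<^bsub>N-j\<^esub>\<close> with
      \<open>\<Gamma>(s - j)\<close>, and \<open>e - c = 1 - N - a\<close> makes \<open>(e - c)\<^bsub>N-j\<^esub>\<close>, up to sign, the complement of \<open>(a)\<^sub>j\<close>
      in \<open>(a)\<^sub>N\<close>.\<close>
  have summand: "(\<Sum>m\<le>N. ?h j m) * suminf (?g j) =
      K * (- 1) ^ N * pochhammer a N / (pochhammer e N * pochhammer d N) *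
      (of_nat (N choose j) * pochhammer (1 + a - e') j * pochhammer b (N - j))" if j: "j \<le> N" for j
  proof -
    have "suminf (?g j) = pochhammer a j * (Gamma e' * Gamma (s - of_nat j) *
        rGamma (e' - a - of_nat j) * rGamma (1 + c))"
      using suminf_mult[OF summable_norm_cancel[OF sum_t[OF j]]] Gauss_2F1_sum[OF e'_notin Re_j[OF j]]
      by (simp add: snd_factor_def[abs_def] e'_def a_def s_def algebra_simps)
    moreover have "rGamma (e' - a - of_nat j) = (- 1) ^ j * pochhammer (1 + a - e') j * rGamma (e' - a)"
      using pochhammer_rGamma[of "e' - a - of_nat j" j] pochhammer_reflect[of "e' - a - of_nat j" j]
      by (simp add: algebra_simps)
    moreover have "Gamma (s - of_nat j) / pochhammer e (N - j) = Gamma s / pochhammer e N"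
    proof -
      have "pochhammer e N = pochhammer e (N - j) * pochhammer (s - of_nat j) j"
        using pochhammer_product[of "N - j" N e] j by (simp add: e_def s_def of_nat_diff algebra_simps)
      moreover have "Gamma s = pochhammer (s - of_nat j) j * Gamma (s - of_nat j)"
        using pochhammer_Gamma[OF s_notin[OF j], of j] s_notin[OF j] by (simp add: Gamma_eq_zero_iff)
      ultimately show ?thesis using e_nz[of N] by simp
    qed
    moreover have "pochhammer a j * pochhammer (e - c) (N - j) = (- 1) ^ (N - j) * pochhammer a N"
      using pochhammer_reflect[of "e - c" "N - j"] pochhammer_product[OF j, of a] j
      by (simp add: e_def a_def of_nat_diff algebra_simps)
    moreover have "(- 1) ^ N = (- 1) ^ j * (- 1 :: complex) ^ (N - j)"
      using j by (simp flip: power_add)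
    moreover have "(\<Sum>m\<le>N. ?h j m) * suminf (?g j) =
      of_nat (N choose j) * pochhammer b (N - j) / pochhammer d N * Gamma e' * rGamma (1 + c) *
       (pochhammer a j * pochhammer (e - c) (N - j)) * rGamma (e' - a - of_nat j) *
       (Gamma (s - of_nat j) / pochhammer e (N - j))"
      unfolding sum_fst_factor[OF j e_nz] calculation(1) by (simp add: mult_ac)
    ultimately show ?thesis by (simp add: K_def mult_ac)
  qed

  have "(?T has_sum (\<Sum>j\<le>N. (\<Sum>m\<le>N. ?h j m) * suminf (?g j))) UNIV"
    unfolding T by (rule has_sum_sum) (rule factors(2))
  then have "kampe_de_feriet d (- of_nat N, b, c) e (d + of_nat N, a, c') e' 1 1 =
      (\<Sum>j\<le>N. (\<Sum>m\<le>N. ?h j m) * suminf (?g j))"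
    unfolding kampe_de_feriet_def by (rule infsumI)
  also have "\<dots> = K * (- 1) ^ N * pochhammer a N / (pochhammer e N * pochhammer d N) *
      pochhammer ((1 + a - e') + b) N"
    using summand unfolding pochhammer_binomial_sum sum_distrib_left by (intro sum.cong) auto
  also have "(1 + a - e') + b = d - c - c'"
    by (simp add: a_def e'_def)
  also have "pochhammer e N = (- 1) ^ N * pochhammer (d - b - c) N"
    by (subst pochhammer_reflect) (simp add: e_def algebra_simps)
  also have "K * (- 1) ^ N * pochhammer a N / ((- 1) ^ N * pochhammer (d - b - c) N * pochhammer d N) *
      pochhammer (d - c - c') N =
      pochhammer a N * pochhammer (d - c - c') N / (pochhammer d N * pochhammer (d - b - c) N) * K"
    by (simp add: mult_ac)
  finally show ?thesis
    using abs unfolding K_def a_def e_def e'_def s_def by (simp add: algebra_simps)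
qed

end
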